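(* For every bipartite state $\rho_{AB}$ on $\mathbb{C}_A\otimes\mathbb{C}_B$, $$E_f^{1/2}(\rho_{AB})=\min_{\{p_i,|\psi_i\rangle\}}\sum_ip_i\,LR_g(\psi_i),$$ where the minimum is over all finite pure-state ensembles $\{p_i,|\psi_i\rangle\}$ with $\rho_{AB}=\sum_ip_i|\psi_i\rangle\langle\psi_i|_{AB}$, and $\psi_i=|\psi_i\rangle\langle\psi_i|$.
   Context: All Hilbert spaces are finite-dimensional complex Hilbert spaces; $\log$ is base 2. A state is a positive semidefinite operator of trace one. $S_{1/2}(\rho)=2\log\mathrm{Tr}(\sqrt\rho)$ is the Rényi entropy $S_\alpha(\rho)=\frac{1}{1-\alpha}\log\mathrm{Tr}(\rho^\alpha)$ at $\alpha=1/2$. The $1/2$-entanglement of formation is $E_f^{1/2}(\rho_{AB})=\inf\sum_ip_iS_{1/2}(\mathrm{Tr}_B|\psi_i\rangle\langle\psi_i|)$, the infimum being over all finite pure-state ensembles $\{p_i,|\psi_i\rangle\langle\psi_i|\}$ with average $\rho_{AB}$. A bipartite state is separable if it is a convex combination of product states; $\mathrm{Sep}$ is the set of separable states. Generalized robustness: $R_G(\rho)=\min\{s\ge0:\exists\text{ a state }\rho_s\text{ with }\frac{\rho+s\rho_s}{1+s}\in\mathrm{Sep}\}$. Log-generalized robustness: $LR_g(\rho)=\log_2(1+R_G(\rho))$. *)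

theory Defs
  imports "HOL-Analysis.Analysis"
begin

text \<open>The Hilbert space with orthonormal basis indexed by a finite type 'n is complex ^ 'n; the
  composite of systems A and B is complex ^ ('a \<times> 'b). Operators are written as matrices in
  these bases.\<close>

type_synonym 'n op = "complex ^ 'n ^ 'n"

definition dagger :: "'n::finite op \<Rightarrow> 'n op" where
  "dagger X = (\<chi> i j. cnj (X $ j $ i))"

definition psd :: "'n::finite op \<Rightarrow> bool" where
  "psd X \<longleftrightarrow> dagger X = X \<and> (\<forall>v. 0 \<le> Re (\<Sum>i\<in>UNIV. cnj (v $ i) * (X *v v) $ i))"

definition state :: "'n::finite op \<Rightarrow> bool" where
  "state \<rho> \<longleftrightarrow> psd \<rho> \<and> trace \<rho> = 1"

definition psd_sqrt :: "'n::finite op \<Rightarrow> 'n op" where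
  "psd_sqrt X = (THE Y. psd Y \<and> Y ** Y = X)"

definition ketbra :: "complex ^ 'n::finite \<Rightarrow> 'n op" where
  "ketbra \<psi> = (\<chi> i j. \<psi> $ i * cnj (\<psi> $ j))"

definition tensor_op :: "'a::finite op \<Rightarrow> 'b::finite op \<Rightarrow> ('a \<times> 'b) op" where
  "tensor_op X Y = (\<chi> r c. X $ fst r $ fst c * Y $ snd r $ snd c)"

definition partial_trace_B :: "('a::finite \<times> 'b::finite) op \<Rightarrow> 'a op" where
  "partial_trace_B X = (\<chi> i j. \<Sum>k\<in>UNIV. X $ (i, k) $ (j, k))"

definition renyi_half :: "'n::finite op \<Rightarrow> real" where
  "renyi_half \<rho> = 2 * log 2 (Re (trace (psd_sqrt \<rho>)))"

definition pure_ensemble :: "'n::finite op \<Rightarrow> (real \<times> (complex ^ 'n)) list \<Rightarrow> bool" where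
  "pure_ensemble \<rho> E \<longleftrightarrow>
     (\<forall>(p, \<psi>) \<in> set E. 0 \<le> p \<and> norm \<psi> = 1) \<and>
     (\<Sum>(p, \<psi>)\<leftarrow>E. p) = 1 \<and>
     (\<Sum>(p, \<psi>)\<leftarrow>E. p *\<^sub>R ketbra \<psi>) = \<rho>"

definition ensemble_averages :: "('n::finite op \<Rightarrow> real) \<Rightarrow> 'n op \<Rightarrow> real set" where
  "ensemble_averages f \<rho> = {(\<Sum>(p, \<psi>)\<leftarrow>E. p * f (ketbra \<psi>)) | E. pure_ensemble \<rho> E}"

definition eof_half :: "('a::finite \<times> 'b::finite) op \<Rightarrow> real" where
  "eof_half \<rho> = Inf (ensemble_averages (\<lambda>X. renyi_half (partial_trace_B X)) \<rho>)"

definition Sep :: "('a::finite \<times> 'b::finite) op set" where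
  "Sep = convex hull {tensor_op \<sigma> \<tau> | \<sigma> \<tau>. state \<sigma> \<and> state \<tau>}"

definition generalized_robustness :: "('a::finite \<times> 'b::finite) op \<Rightarrow> real" where
  "generalized_robustness \<rho> =
     (LEAST s. 0 \<le> s \<and> (\<exists>\<rho>\<^sub>s. state \<rho>\<^sub>s \<and> (1 / (1 + s)) *\<^sub>R (\<rho> + s *\<^sub>R \<rho>\<^sub>s) \<in> Sep))"

definition log_generalized_robustness :: "('a::finite \<times> 'b::finite) op \<Rightarrow> real" where
  "log_generalized_robustness \<rho> = log 2 (1 + generalized_robustness \<rho>)"

end

theory Submission
  imports Defs
begin

text \<open>Let \<open>c\<close> be the sum of the Schmidt coefficients of a unit vector \<open>\<psi>\<close>, so that
  \<open>Tr \<surd>(Tr\<^sub>B \<psi>) = c\<close>. Both quantities agree on every pure state, because \<open>R\<^sub>G(\<psi>) = c\<^sup>2 - 1\<close>: a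
  vector \<open>\<phi>\<close> with \<open>\<bar>\<langle>\<phi>, a \<otimes> b\<rangle>\<bar> \<le> \<parallel>a\<parallel> \<parallel>b\<parallel>\<close> and \<open>\<langle>\<phi>, \<psi>\<rangle> = c\<close> is a witness for the lower bound,
  and averaging product vectors over random signs gives a separable \<open>\<sigma>\<close> with \<open>c\<^sup>2 \<sigma> \<ge> \<psi>\<close>. The same
  witnesses show that \<open>c\<close> is Lipschitz in \<open>\<psi>\<close>. Hence the ensemble averages of \<open>\<rho>\<close> form a slice
  of the convex hull of a compact set, and the infimum is attained.\<close>

section \<open>Operators and the spectral theorem\<close>

definition cinner :: "complex ^ 'n::finite \<Rightarrow> complex ^ 'n \<Rightarrow> complex" where
  "cinner u v = (\<Sum>i\<in>UNIV. cnj (u $ i) * v $ i)"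

lemma scaleR_complex: "r *\<^sub>R z = of_real r * (z :: complex)"
  by (rule scaleR_conv_of_real)

text \<open>Bridge to the real Euclidean structure, from which orthogonality and Cauchy-Schwarz are
  imported.\<close>

lemma Re_cinner: "Re (cinner u v) = u \<bullet> v"
  by (simp add: cinner_def inner_vec_def inner_complex_def)

lemma cinner_add_left: "cinner (u + v) w = cinner u w + cinner v w"
  by (simp add: cinner_def algebra_simps sum.distrib)

lemma cinner_add_right: "cinner w (u + v) = cinner w u + cinner w v"
  by (simp add: cinner_def algebra_simps sum.distrib)

lemma cinner_diff_right: "cinner w (u - v) = cinner w u - cinner w v"
  by (simp add: cinner_def algebra_simps sum_subtractf)

lemma cinner_mult_left: "cinner (c *s u) v = cnj c * cinner u v"
  by (simp add: cinner_def sum_distrib_left mult_ac)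

lemma cinner_mult_right: "cinner u (c *s v) = c * cinner u v"
  by (simp add: cinner_def sum_distrib_left mult_ac)

lemma cinner_scaleR_right: "cinner u (r *\<^sub>R v) = of_real r * cinner u v"
  by (simp add: cinner_def sum_distrib_left scaleR_complex mult_ac)

lemma cinner_scaleR_left: "cinner (r *\<^sub>R u) v = of_real r * cinner u v"
  by (simp add: cinner_def sum_distrib_left scaleR_complex mult_ac)

lemma cinner_zero_left [simp]: "cinner 0 v = 0"
  by (simp add: cinner_def)

lemma cinner_zero_right [simp]: "cinner v 0 = 0"
  by (simp add: cinner_def)

lemma cinner_sum_left: "cinner (\<Sum>k\<in>S. f k) v = (\<Sum>k\<in>S. cinner (f k) v)"
  by (induction S rule: infinite_finite_induct) (simp_all add: cinner_add_left)

lemma cinner_sum_right: "cinner v (\<Sum>k\<in>S. f k) = (\<Sum>k\<in>S. cinner v (f k))"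
  by (induction S rule: infinite_finite_induct) (simp_all add: cinner_add_right)

lemma cnj_cinner: "cnj (cinner u v) = cinner v u"
  by (simp add: cinner_def mult.commute)

lemma norm_cinner_commute: "cmod (cinner u v) = cmod (cinner v u)"
  by (metis cnj_cinner complex_mod_cnj)

lemma cinner_self: "cinner v v = of_real ((norm v)\<^sup>2)"
proof (rule complex_eqI)
  show "Im (cinner v v) = Im (of_real ((norm v)\<^sup>2))"
    using cnj_cinner[of v v] by (metis Im_complex_of_real Reals_cnj_iff complex_is_Real_iff)
qed (simp add: Re_cinner dot_square_norm)

lemma norm_vec_mult: "norm (c *s (v :: complex ^ 'n::finite)) = cmod c * norm v"
  by (simp add: norm_vec_def L2_set_def norm_mult power_mult_distrib
      flip: sum_distrib_left real_sqrt_mult)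
    (simp add: real_sqrt_mult)

lemma norm_cinner_le: "cmod (cinner u v) \<le> norm u * norm v"
proof -
  define z where "z = cinner u v"
  \<comment> \<open>Multiplying \<open>v\<close> by \<open>cnj z\<close> makes the inner product
    real, so that the real Cauchy-Schwarz inequality applies.\<close>
  have "cmod z * cmod z = Re (cnj z * z)"
    by (simp add: complex_norm_square[symmetric] mult.commute power2_eq_square[symmetric] del: of_real_power)
  also have "\<dots> = u \<bullet> (cnj z *s v)"
    by (simp add: Re_cinner[symmetric] cinner_mult_right z_def)
  also have "\<dots> \<le> norm u * (cmod z * norm v)"
    by (metis Cauchy_Schwarz_ineq2 abs_le_D1 complex_mod_cnj norm_vec_mult)
  finally have "cmod z * cmod z \<le> cmod z * (norm u * norm v)" by (simp add: mult_ac)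
  then show ?thesis
    unfolding z_def[symmetric]
    by (cases "z = 0") auto
qed

lemma cinner_adjoint: "cinner u (X *v v) = cinner (dagger X *v u) v"
proof -
  have "cinner u (X *v v) = (\<Sum>i\<in>UNIV. \<Sum>j\<in>UNIV. cnj (u $ i) * X $ i $ j * v $ j)"
    by (simp add: cinner_def matrix_vector_mult_def sum_distrib_left mult_ac)
  also have "\<dots> = (\<Sum>j\<in>UNIV. \<Sum>i\<in>UNIV. cnj (u $ i) * X $ i $ j * v $ j)"
    by (rule sum.swap)
  also have "\<dots> = cinner (dagger X *v u) v"
    by (simp add: cinner_def matrix_vector_mult_def dagger_def sum_distrib_right sum_distrib_left mult_ac)
  finally show ?thesis .
qed

lemma psd_iff: "psd X \<longleftrightarrow> dagger X = X \<and> (\<forall>v. 0 \<le> Re (cinner v (X *v v)))"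
  by (simp add: psd_def cinner_def)

lemma mult_vec_right: "X *v (c *s v) = c *s (X *v v :: complex ^ 'm::finite)"
  by (simp add: vec_eq_iff matrix_vector_mult_def sum_distrib_left mult_ac)

lemma mult_vec_scaleR_right: "X *v (r *\<^sub>R v) = r *\<^sub>R (X *v v :: complex ^ 'm::finite)"
  by (simp add: vec_eq_iff matrix_vector_mult_def scaleR_sum_right)

lemma mult_vec_sum_left: "(\<Sum>k\<in>S. f k :: complex ^ 'n ^ 'm) *v v = (\<Sum>k\<in>S. f k *v v)"
  by (induction S rule: infinite_finite_induct)
     (simp_all add: matrix_vector_mult_add_rdistrib)

lemma mult_vec_scaleR_left: "(r *\<^sub>R X) *v v = r *\<^sub>R (X *v v :: complex ^ 'm::finite)"
  by (simp add: vec_eq_iff matrix_vector_mult_def scaleR_sum_right)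

lemma ketbra_mult_vec: "ketbra u *v v = cinner u v *s u"
  by (simp add: vec_eq_iff matrix_vector_mult_def ketbra_def cinner_def sum_distrib_left mult_ac)

lemma cinner_ketbra: "cinner v (ketbra u *v v) = of_real ((cmod (cinner u v))\<^sup>2)"
  by (simp add: ketbra_mult_vec cinner_mult_right complex_norm_square cnj_cinner del: of_real_power)

lemma dagger_ketbra: "dagger (ketbra u) = ketbra u"
  by (simp add: dagger_def ketbra_def vec_eq_iff mult.commute)

lemma dagger_add: "dagger (X + Y) = dagger X + dagger Y"
  by (simp add: dagger_def vec_eq_iff)

lemma dagger_diff: "dagger (X - Y) = dagger X - dagger Y"
  by (simp add: dagger_def vec_eq_iff)

lemma dagger_scaleR: "dagger (r *\<^sub>R X) = r *\<^sub>R dagger X"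
  by (simp add: dagger_def vec_eq_iff)

lemma dagger_zero: "dagger 0 = 0"
  by (simp add: dagger_def vec_eq_iff)

lemma dagger_sum: "dagger (\<Sum>k\<in>S. f k) = (\<Sum>k\<in>S. dagger (f k))"
  by (induction S rule: infinite_finite_induct) (simp_all add: dagger_add dagger_zero)

lemma trace_ketbra: "trace (ketbra u) = of_real ((norm u)\<^sup>2)"
  by (simp add: trace_def ketbra_def cinner_def mult.commute flip: cinner_self del: of_real_power)

lemma trace_scaleR: "trace (r *\<^sub>R X) = of_real r * trace (X :: 'n::finite op)"
  by (simp add: trace_def sum_distrib_left scaleR_complex)

lemma trace_sum: "trace (\<Sum>k\<in>S. f k :: 'n::finite op) = (\<Sum>k\<in>S. trace (f k))"
  by (induction S rule: infinite_finite_induct) (simp_all add: trace_add trace_0[unfolded mat_0])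

section \<open>Orthonormal bases and eigenvectors\<close>

definition onb :: "('n \<Rightarrow> complex ^ 'n::finite) \<Rightarrow> bool" where
  "onb e \<longleftrightarrow> (\<forall>i j. cinner (e i) (e j) = (if i = j then 1 else 0))"

text \<open>Complex orthogonality to \<open>S\<close> is real orthogonality to \<open>S\<close> and
  to \<open>\<i> *s u\<close> for \<open>u\<close> in \<open>S\<close>. These are at most
  \<open>2 * card S\<close> vectors, fewer than the real dimension
  \<open>2 * CARD('n)\<close>.\<close>

lemma exists_orthogonal_vector:
  fixes S :: "(complex ^ 'n::finite) set"
  assumes "finite S" "card S < CARD('n)"
  shows "\<exists>v. v \<noteq> 0 \<and> (\<forall>u\<in>S. cinner u v = 0)"
proof -
  define T where "T = S \<union> (\<lambda>u. \<i> *s u) ` S"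
  have "finite T" using assms by (simp add: T_def)
  have "card T \<le> card S + card S"
    unfolding T_def using card_Un_le[of S "(\<lambda>u. \<i> *s u) ` S"] card_image_le[OF assms(1), of "\<lambda>u. \<i> *s u"]
    by linarith
  moreover have "dim (span T) \<le> card T"
    by (metis \<open>finite T\<close> dim_le_card dim_span span_superset span_span subset_refl)
  ultimately have "dim (span T) < DIM(complex ^ 'n)" using assms by simp
  then obtain x where x: "x \<noteq> 0" "\<And>y. y \<in> span (span T) \<Longrightarrow> orthogonal x y"
    using orthogonal_to_subspace_exists by metis
  have "cinner u x = 0" if "u \<in> S" for u
  proof (rule complex_eqI)
    have "u \<bullet> x = 0"
      using x(2)[of u] that unfolding span_span by (simp add: T_def span_base orthogonal_def inner_commute)
    then show "Re (cinner u x) = Re 0" by (simp add: Re_cinner)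
    have "(\<i> *s u) \<bullet> x = 0"
      using x(2)[of "\<i> *s u"] that unfolding span_span by (simp add: T_def span_base orthogonal_def inner_commute)
    then show "Im (cinner u x) = Im 0" by (simp add: Re_cinner[symmetric] cinner_mult_left)
  qed
  then show ?thesis using x(1) by blast
qed

lemma continuous_on_quadratic:
  "continuous_on S (\<lambda>v :: complex ^ 'n::finite. Re (cinner v (X *v v)))"
  unfolding cinner_def matrix_vector_mult_def by (simp, intro continuous_intros)

text \<open>First-order condition: for small positive \<open>t\<close> the linear term would
  outweigh the quadratic one.\<close>

lemma quadratic_nonneg_imp_zero:
  fixes a q :: real
  assumes "\<And>t. 0 \<le> t\<^sup>2 * q - 2 * t * a" "0 \<le> a"
  shows "a = 0"
proof (rule ccontr)
  assume "a \<noteq> 0"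
  then have a: "a > 0" using assms by simp
  \<comment> \<open>This \<open>t\<close> gives \<open>t * q \<le> a\<close>, so the quadratic is at
    most \<open>- t * a\<close>.\<close>
  define t where "t = a / (\<bar>q\<bar> + 1)"
  have t: "t > 0" using a by (simp add: t_def)
  have "t * (\<bar>q\<bar> + 1) = a" by (simp add: t_def)
  then have "t * q \<le> a" using t by (smt (verit) mult_left_mono mult_less_cancel_left_pos)
  then have "t * (t * q) \<le> t * a" using t by simp
  moreover have "t * a > 0" using t a by simp
  ultimately show False using assms(1)[of t] by (simp add: power2_eq_square mult_ac)
qed

text \<open>The next eigenvector maximises the Rayleigh quotient on the orthogonal complement of the
  eigenvectors found so far.\<close>

lemma exists_orthogonal_eigenvector:
  fixes X :: "'n::finite op"
  assumes herm: "dagger X = X" and fin: "finite S" and card: "card S < CARD('n)"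
    and eig: "\<And>u. u \<in> S \<Longrightarrow> \<exists>l. X *v u = l *s u"
  shows "\<exists>v l. norm v = 1 \<and> (\<forall>u\<in>S. cinner u v = 0) \<and> X *v v = of_real l *s v"
proof -
  define V where "V = {v. \<forall>u\<in>S. cinner u v = 0}"
  let ?f = "\<lambda>v. Re (cinner v (X *v v))"
  \<comment> \<open>A Hermitian \<open>X\<close> preserves the orthogonal complement of a set of
    eigenvectors.\<close>
  have XV: "X *v v \<in> V" if "v \<in> V" for v
  proof -
    have "cinner u (X *v v) = 0" if u: "u \<in> S" for u
    proof -
      obtain l where "X *v u = l *s u" using eig u by blast
      then show ?thesis using \<open>v \<in> V\<close> u
        by (simp add: cinner_adjoint herm cinner_mult_left V_def)
    qed
    then show ?thesis by (simp add: V_def)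
  qed
  obtain v0 where v0: "v0 \<noteq> 0" "v0 \<in> V"
    using exists_orthogonal_vector[OF fin card] by (auto simp: V_def)
  have scV: "r *\<^sub>R v \<in> V" if "v \<in> V" for r v
    using that by (simp add: V_def cinner_scaleR_right)
  have diffV: "u - v \<in> V" if "u \<in> V" "v \<in> V" for u v
    using that by (simp add: V_def cinner_diff_right)
  have "closed V"
  proof -
    have "V = (\<Inter>u\<in>S. {v. cinner u v = 0})" by (auto simp: V_def)
    moreover have "closed {v. cinner u v = 0}" for u :: "complex ^ 'n"
      unfolding cinner_def by (intro closed_Collect_eq continuous_intros)
    ultimately show ?thesis by auto
  qed
  then have "compact (sphere 0 1 \<inter> V)" by (intro compact_Int_closed) auto
  moreover have "(1 / norm v0) *\<^sub>R v0 \<in> sphere 0 1 \<inter> V" using v0 scV by simp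
  ultimately obtain v where v: "v \<in> sphere 0 1 \<inter> V" and vmax: "\<And>w. w \<in> sphere 0 1 \<inter> V \<Longrightarrow> ?f w \<le> ?f v"
    using continuous_attains_sup[of "sphere 0 1 \<inter> V" ?f] continuous_on_quadratic by blast
  define l where "l = ?f v"
  have le: "?f w \<le> l * (norm w)\<^sup>2" if "w \<in> V" for w
  proof (cases "w = 0")
    case False
    have "?f ((1 / norm w) *\<^sub>R w) \<le> l"
      using vmax[of "(1 / norm w) *\<^sub>R w"] False that scV by (simp add: l_def)
    moreover have "?f ((1 / norm w) *\<^sub>R w) = ?f w / (norm w)\<^sup>2"
      by (simp add: mult_vec_scaleR_right cinner_scaleR_left cinner_scaleR_right
          power2_eq_square flip: of_real_mult of_real_divide)
    ultimately show ?thesis using False by (simp add: divide_simps)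
  qed simp
  \<comment> \<open>\<open>w\<close> is the residual of the eigenvalue equation; it lies in
    \<open>V\<close>, so \<open>v\<close> may be perturbed along it.\<close>
  define w where "w = of_real l *s v - X *v v"
  have lv: "of_real l *s v = l *\<^sub>R v" by (simp add: vec_eq_iff scaleR_complex)
  have w: "w \<in> V" unfolding w_def lv using v XV scV diffV by auto
  \<comment> \<open>\<open>Y\<close> is the quadratic form of \<open>l - X\<close>: nonnegative on
    \<open>V\<close> and zero at \<open>v\<close>. Moving from \<open>v\<close> by
    \<open>- t *\<^sub>R w\<close> has first-order term \<open>- 2 * t * (norm w)\<^sup>2\<close>,
    which forces \<open>w = 0\<close>.\<close>
  define Y where "Y u = l * (norm u)\<^sup>2 - ?f u" for u
  have "0 \<le> t\<^sup>2 * Y w - 2 * t * (norm w)\<^sup>2" for t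
  proof -
    have "0 \<le> Y (v - t *\<^sub>R w)"
      unfolding Y_def using le[of "v - t *\<^sub>R w"] v w scV diffV by auto
    also have "Y (v - t *\<^sub>R w) = Y v + t\<^sup>2 * Y w - 2 * t * (w \<bullet> w)"
    proof -
      have sym: "Re (cinner v (X *v w)) = Re (cinner w (X *v v))"
        by (metis cinner_adjoint herm Re_cinner inner_commute)
      have "w \<bullet> w = w \<bullet> (l *\<^sub>R v) - w \<bullet> (X *v v)"
        unfolding w_def lv by (simp add: inner_diff_left inner_diff_right)
      then have "t * (l * (v \<bullet> w)) = t * (w \<bullet> w) + t * (w \<bullet> (X *v v))"
        by (simp add: inner_commute flip: distrib_left)
      then show ?thesis using sym
        unfolding Y_def power2_norm_eq_inner mult_vec_scaleR_right matrix_vector_mult_diff_distrib Re_cinner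
        by (simp add: inner_diff_left inner_diff_right algebra_simps power2_eq_square inner_commute)
    qed
    also have "Y v = 0" using v by (simp add: Y_def l_def)
    finally show ?thesis by (simp add: power2_norm_eq_inner)
  qed
  then have "(norm w)\<^sup>2 = 0" by (rule quadratic_nonneg_imp_zero) simp
  then have "X *v v = of_real l *s v" by (simp add: w_def)
  then show ?thesis using v by (auto simp: V_def)
qed

text \<open>Induction on \<open>k\<close>; the case \<open>k = CARD('n)\<close> supplies a full
  eigenbasis.\<close>

lemma exists_orthonormal_eigenvectors:
  fixes X :: "'n::finite op"
  assumes "dagger X = X" "k \<le> CARD('n)"
  shows "\<exists>S. finite S \<and> card S = k \<and> (\<forall>u\<in>S. norm u = 1 \<and> (\<exists>l::real. X *v u = of_real l *s u)) \<and>
    (\<forall>u\<in>S. \<forall>v\<in>S. u \<noteq> v \<longrightarrow> cinner u v = 0)"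
  using assms(2)
proof (induction k)
  case 0
  show ?case by (rule exI[of _ "{}"]) simp
next
  case (Suc k)
  then obtain S where S: "finite S" "card S = k" "\<forall>u\<in>S. norm u = 1 \<and> (\<exists>l::real. X *v u = of_real l *s u)"
    "\<forall>u\<in>S. \<forall>v\<in>S. u \<noteq> v \<longrightarrow> cinner u v = 0" by auto
  obtain v l where v: "norm v = 1" "\<forall>u\<in>S. cinner u v = 0" "X *v v = complex_of_real l *s v"
    using exists_orthogonal_eigenvector[OF assms(1) S(1)] S(2,3) Suc.prems by (metis Suc_le_lessD)
  have "v \<notin> S" using v(1,2) by (auto simp: cinner_self)
  moreover have "\<forall>u\<in>S. cinner v u = 0" using v(2) by (metis cnj_cinner complex_cnj_zero)
  ultimately show ?case using S v by (intro exI[of _ "insert v S"]) auto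
qed

lemma onb_expansion:
  assumes "onb e"
  shows "(\<Sum>j\<in>UNIV. cinner (e j) v *s e j) = v"
proof -
  define U :: "'a op" where "U = (\<chi> i j. e j $ i)"
  have "dagger U ** U = mat 1"
    using assms by (simp add: U_def dagger_def matrix_matrix_mult_def mat_def vec_eq_iff onb_def cinner_def)
  \<comment> \<open>\<open>U\<close> has the basis vectors as columns; for a square matrix a left
    inverse is also a right inverse.\<close>
  then have "U ** dagger U = mat 1" by (metis matrix_left_right_inverse)
  then have "U *v (dagger U *v v) = v" by (simp add: matrix_vector_mul_assoc)
  moreover have "U *v (dagger U *v v) = (\<Sum>j\<in>UNIV. cinner (e j) v *s e j)"
    by (simp add: vec_eq_iff matrix_vector_mult_def U_def dagger_def cinner_def mult.commute)
  ultimately show ?thesis by simp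
qed

lemma mult_vec_sum_right: "X *v (\<Sum>k\<in>S. f k) = (\<Sum>k\<in>S. X *v f k :: complex ^ 'm::finite)"
  by (induction S rule: infinite_finite_induct) (simp_all add: matrix_vector_right_distrib)

lemma onb_operator_eqI:
  assumes "onb e" "\<And>j. X *v e j = Y *v e j"
  shows "X = (Y :: 'n::finite op)"
proof -
  have "X *v v = Y *v v" for v
    by (subst (1 2) onb_expansion[OF assms(1), of v, symmetric])
       (simp add: mult_vec_sum_right mult_vec_right assms(2))
  then show ?thesis by (simp add: matrix_eq)
qed

lemma onb_sum_ketbra_mult_vec:
  assumes "onb e"
  shows "(\<Sum>j\<in>UNIV. l j *\<^sub>R ketbra (e j)) *v e k = l k *\<^sub>R e k"
proof -
  have "(\<Sum>j\<in>UNIV. l j *\<^sub>R ketbra (e j)) *v e k = (\<Sum>j\<in>UNIV. if j = k then l k *\<^sub>R e k else 0)"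
    unfolding mult_vec_sum_left mult_vec_scaleR_left ketbra_mult_vec
    using assms by (intro sum.cong) (auto simp: onb_def)
  then show ?thesis by simp
qed

lemma spectral_decomposition:
  fixes X :: "'n::finite op"
  assumes "dagger X = X"
  obtains e and l :: "'n \<Rightarrow> real" where "onb e" "X = (\<Sum>j\<in>UNIV. l j *\<^sub>R ketbra (e j))"
proof -
  obtain S where S: "finite S" "card S = CARD('n)"
    "\<And>u. u\<in>S \<Longrightarrow> norm u = 1 \<and> (\<exists>l::real. X *v u = of_real l *s u)"
    "\<forall>u\<in>S. \<forall>v\<in>S. u \<noteq> v \<longrightarrow> cinner u v = 0"
    using exists_orthonormal_eigenvectors[OF assms order_refl] by blast
  \<comment> \<open>There are as many eigenvectors as elements of \<open>'n\<close>, so they can be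
    indexed by it.\<close>
  obtain e where e: "bij_betw e (UNIV :: 'n set) S"
    using finite_same_card_bij[OF finite S(1) S(2)[symmetric]] by blast
  then have eS: "e i \<in> S" for i by (auto simp: bij_betw_def)
  then have "\<forall>i. \<exists>l::real. X *v e i = of_real l *s e i"
    using S(3) by blast
  then obtain l :: "'n \<Rightarrow> real" where l: "\<And>i. X *v e i = of_real (l i) *s e i"
    by metis
  have "onb e"
    unfolding onb_def
  proof (intro allI)
    fix i j
    show "cinner (e i) (e j) = (if i = j then 1 else 0)"
    proof (cases "i = j")
      case True
      then show ?thesis using S(3)[OF eS, of i] by (simp add: cinner_self)
    next
      case False
      then show ?thesis using S(4) eS bij_betw_imp_inj_on[OF e] by (simp add: inj_eq)
    qed
  qed
  moreover from this have "X = (\<Sum>j\<in>UNIV. l j *\<^sub>R ketbra (e j))"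
    by (rule onb_operator_eqI)
       (simp only: onb_sum_ketbra_mult_vec[OF calculation] l, simp add: vec_eq_iff scaleR_complex)
  ultimately show ?thesis using that by blast
qed

lemma onb_norm:
  assumes "onb e"
  shows "norm (e j) = 1"
proof -
  have "complex_of_real ((norm (e j))\<^sup>2) = of_real 1"
    using assms by (simp only: cinner_self[symmetric] onb_def simp_thms if_True of_real_1)
  then have "(norm (e j))\<^sup>2 = 1" by (simp only: of_real_eq_iff)
  then show ?thesis using norm_ge_zero[of "e j"] by (simp add: power2_eq_1_iff)
qed

lemma psd_spectral_decomposition:
  fixes X :: "'n::finite op"
  assumes "psd X"
  obtains e and l :: "'n \<Rightarrow> real" where "onb e" "X = (\<Sum>j\<in>UNIV. l j *\<^sub>R ketbra (e j))" "\<And>j. 0 \<le> l j"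
proof -
  obtain e and l :: "'n \<Rightarrow> real" where e: "onb e" "X = (\<Sum>j\<in>UNIV. l j *\<^sub>R ketbra (e j))"
    using spectral_decomposition assms psd_iff by metis
  have "0 \<le> l j" for j
  proof -
    have "0 \<le> Re (cinner (e j) (X *v e j))" using assms by (simp add: psd_iff)
    also have "\<dots> = l j" unfolding e(2) onb_sum_ketbra_mult_vec[OF e(1)]
      using e(1) by (simp add: cinner_scaleR_right onb_def)
    finally show ?thesis .
  qed
  with e that show ?thesis by blast
qed

section \<open>Positive square roots and their traces\<close>

lemma psd_sum_ketbra:
  assumes "\<And>j. j \<in> S \<Longrightarrow> 0 \<le> l j"
  shows "psd (\<Sum>j\<in>S. l j *\<^sub>R ketbra (e j))"
  using assms
  by (auto simp: psd_iff dagger_sum dagger_scaleR dagger_ketbra mult_vec_sum_left mult_vec_scaleR_left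
      cinner_sum_right cinner_scaleR_right cinner_ketbra intro!: sum_nonneg)

text \<open>\<open>psd_sqrt\<close> is a definite description, so uniqueness is required. It
  suffices to show \<open>Y *v e j = sqrt (l j) *\<^sub>R e j\<close> on every basis vector.\<close>

lemma psd_sqrt_unique:
  assumes Y: "psd Y" and YY: "Y ** Y = (\<Sum>j\<in>UNIV. l j *\<^sub>R ketbra (e j))"
    and e: "onb e" and l: "\<And>j. 0 \<le> l j"
  shows "Y = (\<Sum>j\<in>UNIV. sqrt (l j) *\<^sub>R ketbra (e j))"
proof (rule onb_operator_eqI[OF e])
  fix j
  have herm: "dagger Y = Y" and pos: "0 \<le> Re (cinner v (Y *v v))" for v
    using Y by (auto simp: psd_iff)
  define s where "s = sqrt (l j)"
  define w where "w = Y *v e j - s *\<^sub>R e j"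
  have s: "s \<ge> 0" "s * s = l j" using l[of j] by (auto simp: s_def)
  have YYe: "Y *v (Y *v e j) = l j *\<^sub>R e j"
    by (simp only: matrix_vector_mul_assoc YY onb_sum_ketbra_mult_vec[OF e])
  \<comment> \<open>\<open>(Y + s) w = 0\<close> with \<open>Y + s\<close> positive definite unless \<open>s = 0\<close>.\<close>
  have "w = 0"
  proof (cases "s = 0")
    case True
    \<comment> \<open>Here \<open>(norm (Y *v e j))\<^sup>2\<close> equals the inner product of
      \<open>e j\<close> with \<open>Y *v (Y *v e j)\<close>, which vanishes.\<close>
    then have "Y *v (Y *v e j) = 0" using YYe s by simp
    have "cinner (Y *v e j) (Y *v e j) = cinner (e j) (Y *v (Y *v e j))"
      by (metis cinner_adjoint herm)
    then have "cinner (Y *v e j) (Y *v e j) = 0"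
      using \<open>Y *v (Y *v e j) = 0\<close> by (simp only: cinner_zero_right)
    then show ?thesis using True by (simp add: w_def cinner_self)
  next
    case False
    have "Y *v w = - s *\<^sub>R w"
      unfolding w_def by (simp add: matrix_vector_mult_diff_distrib YYe mult_vec_scaleR_right
          algebra_simps s(2))
    then have "0 \<le> - s * (norm w)\<^sup>2"
      using pos[of w] by (simp add: Re_cinner power2_norm_eq_inner)
    moreover have "s > 0" using False s by simp
    ultimately show ?thesis by (simp add: mult_le_0_iff)
  qed
  then show "Y *v e j = (\<Sum>j\<in>UNIV. sqrt (l j) *\<^sub>R ketbra (e j)) *v e j"
    by (simp add: onb_sum_ketbra_mult_vec[OF e] w_def s_def)
qed

lemma psd_sqrt_eq:
  assumes e: "onb e" and l: "\<And>j. 0 \<le> l j"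
  shows "psd_sqrt (\<Sum>j\<in>UNIV. l j *\<^sub>R ketbra (e j)) = (\<Sum>j\<in>UNIV. sqrt (l j) *\<^sub>R ketbra (e j))"
  unfolding psd_sqrt_def
proof (rule the_equality)
  let ?Y = "\<Sum>j\<in>UNIV. sqrt (l j) *\<^sub>R ketbra (e j)"
  have "psd ?Y" by (rule psd_sum_ketbra) (simp add: l)
  moreover have "?Y ** ?Y = (\<Sum>j\<in>UNIV. l j *\<^sub>R ketbra (e j))"
    by (rule onb_operator_eqI[OF e])
       (simp only: onb_sum_ketbra_mult_vec[OF e] mult_vec_scaleR_right matrix_vector_mul_assoc[symmetric]
          scaleR_scaleR real_sqrt_mult_self abs_of_nonneg[OF l])
  ultimately show "psd ?Y \<and> ?Y ** ?Y = (\<Sum>j\<in>UNIV. l j *\<^sub>R ketbra (e j))" ..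
next
  fix Y assume "psd Y \<and> Y ** Y = (\<Sum>j\<in>UNIV. l j *\<^sub>R ketbra (e j))"
  then show "Y = (\<Sum>j\<in>UNIV. sqrt (l j) *\<^sub>R ketbra (e j))"
    by (intro psd_sqrt_unique[OF _ _ e l]) auto
qed

lemma trace_psd_sqrt:
  assumes "onb e" "\<And>j. 0 \<le> l j"
  shows "trace (psd_sqrt (\<Sum>j\<in>UNIV. l j *\<^sub>R ketbra (e j))) = of_real (\<Sum>j\<in>UNIV. sqrt (l j))"
  by (simp add: psd_sqrt_eq[OF assms] trace_sum trace_scaleR trace_ketbra onb_norm[OF assms(1)])

section \<open>Schmidt decomposition and separable states\<close>

definition tens :: "complex ^ 'a::finite \<Rightarrow> complex ^ 'b::finite \<Rightarrow> complex ^ ('a \<times> 'b)" where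
  "tens a b = (\<chi> p. a $ fst p * b $ snd p)"

lemma tens_sum_left: "tens (\<Sum>k\<in>S. f k) b = (\<Sum>k\<in>S. tens (f k) b)"
  by (simp add: tens_def vec_eq_iff sum_distrib_right)

lemma tens_sum_right: "tens a (\<Sum>k\<in>S. f k) = (\<Sum>k\<in>S. tens a (f k))"
  by (simp add: tens_def vec_eq_iff sum_distrib_left)

lemma tens_scaleR_left: "tens (r *\<^sub>R a) b = r *\<^sub>R tens a b"
  by (simp add: tens_def vec_eq_iff)

lemma tens_scaleR_right: "tens a (r *\<^sub>R b) = r *\<^sub>R tens a b"
  by (simp add: tens_def vec_eq_iff)

lemma sum_UNIV_prod:
  "(\<Sum>p\<in>UNIV. g p) = (\<Sum>i\<in>(UNIV :: 'a::finite set). \<Sum>k\<in>(UNIV :: 'b::finite set). g (i, k))"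
  by (simp add: sum.cartesian_product flip: UNIV_Times_UNIV)

lemma cinner_tens: "cinner (tens a b) (tens c d) = cinner a c * cinner b d"
  by (simp add: cinner_def sum_UNIV_prod sum_product) (simp add: tens_def mult_ac)

lemma norm_tens: "norm (tens a b) = norm a * norm b"
proof -
  have "complex_of_real ((norm (tens a b))\<^sup>2) = of_real ((norm a * norm b)\<^sup>2)"
    by (simp only: cinner_self[symmetric] cinner_tens of_real_mult power_mult_distrib)
  then have "(norm (tens a b))\<^sup>2 = (norm a * norm b)\<^sup>2" by (simp only: of_real_eq_iff)
  then show ?thesis by simp
qed

lemma tensor_op_ketbra: "tensor_op (ketbra a) (ketbra b) = ketbra (tens a b)"
  by (simp add: tensor_op_def ketbra_def tens_def vec_eq_iff mult_ac)

lemma tensor_op_sum_left: "tensor_op (\<Sum>k\<in>S. f k) Y = (\<Sum>k\<in>S. tensor_op (f k) Y)"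
  by (simp add: tensor_op_def vec_eq_iff sum_distrib_right)

lemma tensor_op_sum_right: "tensor_op X (\<Sum>k\<in>S. f k) = (\<Sum>k\<in>S. tensor_op X (f k))"
  by (simp add: tensor_op_def vec_eq_iff sum_distrib_left)

lemma tensor_op_scaleR_left: "tensor_op (r *\<^sub>R X) Y = r *\<^sub>R tensor_op X Y"
  by (simp add: tensor_op_def vec_eq_iff)

lemma tensor_op_scaleR_right: "tensor_op X (r *\<^sub>R Y) = r *\<^sub>R tensor_op X Y"
  by (simp add: tensor_op_def vec_eq_iff)

lemma trace_tensor_op: "trace (tensor_op X Y) = trace X * trace Y"
  by (simp add: trace_def sum_UNIV_prod sum_product) (simp add: tensor_op_def)

text \<open>Diagonalize the reduced operator and expand every column of \<psi> in its eigenbasis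
  \<open>e\<close>; the parts on the second system are then orthogonal, with squared norms equal to
  the eigenvalues. All families are indexed by \<open>'a\<close>, which may be larger than
  \<open>'b\<close>, so \<open>f j\<close> is a unit vector where \<open>s j \<noteq> 0\<close> and
  vanishes elsewhere.\<close>

lemma schmidt_decomposition:
  fixes \<psi> :: "complex ^ ('a::finite \<times> 'b::finite)"
  obtains e :: "'a \<Rightarrow> complex ^ 'a" and f :: "'a \<Rightarrow> complex ^ 'b" and s :: "'a \<Rightarrow> real"
  where "onb e" "\<And>j. 0 \<le> s j" "\<psi> = (\<Sum>j\<in>UNIV. s j *\<^sub>R tens (e j) (f j))"
    "\<And>i j. cinner (f i) (f j) = (if i = j \<and> s j \<noteq> 0 then 1 else 0)"
    "partial_trace_B (ketbra \<psi>) = (\<Sum>j\<in>UNIV. (s j)\<^sup>2 *\<^sub>R ketbra (e j))"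
proof -
  define c where "c k = (\<chi> i. \<psi> $ (i, k))" for k
  let ?X = "partial_trace_B (ketbra \<psi>)"
  have X: "?X = (\<Sum>k\<in>UNIV. 1 *\<^sub>R ketbra (c k))"
    by (simp add: partial_trace_B_def ketbra_def c_def vec_eq_iff)
  have "psd ?X" unfolding X by (rule psd_sum_ketbra) simp
  then obtain e and l :: "'a \<Rightarrow> real" where e: "onb e"
    and Xe: "?X = (\<Sum>j\<in>UNIV. l j *\<^sub>R ketbra (e j))" and l: "\<And>j. 0 \<le> l j"
    by (rule psd_spectral_decomposition) (rule that; assumption)
  define s where "s j = sqrt (l j)" for j
  define w where "w j = (\<chi> k. cinner (e j) (c k))" for j
  \<comment> \<open>Where \<open>s j = 0\<close>, division by zero makes
    \<open>f j = 0\<close>.\<close>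
  define f where "f j = (1 / s j) *\<^sub>R w j" for j
  have s: "0 \<le> s j" "(s j)\<^sup>2 = l j" for j using l[of j] by (simp_all add: s_def)
  \<comment> \<open>The Gram matrix of \<open>w\<close> is, up to transposition, the matrix of the
    reduced operator in the basis \<open>e\<close>, hence diagonal.\<close>
  have ww: "cinner (w i) (w j) = (if i = j then of_real ((s j)\<^sup>2) else 0)" for i j
  proof -
    have "cinner (w i) (w j) = (\<Sum>k\<in>UNIV. cinner (e j) (ketbra (c k) *v e i))"
      unfolding ketbra_mult_vec cinner_mult_right cinner_def[of "w i" "w j"] by (simp add: w_def cnj_cinner)
    also have "\<dots> = cinner (e j) (?X *v e i)"
      unfolding X by (simp add: cinner_sum_right mult_vec_sum_left)
    also have "\<dots> = of_real (l i) * cinner (e j) (e i)"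
      unfolding Xe onb_sum_ketbra_mult_vec[OF e] by (rule cinner_scaleR_right)
    also have "\<dots> = (if i = j then of_real ((s j)\<^sup>2) else 0)"
      using e by (simp add: onb_def s(2) del: of_real_power)
    finally show ?thesis .
  qed
  have w: "w j = s j *\<^sub>R f j" for j
  proof (cases "s j = 0")
    case True
    then show ?thesis using ww[of j j] by (simp add: cinner_self)
  qed (simp add: f_def)
  have "\<psi> $ (i, k) = (\<Sum>j\<in>UNIV. tens (e j) (w j)) $ (i, k)" for i k
  proof -
    have "\<psi> $ (i, k) = c k $ i" by (simp add: c_def)
    also have "\<dots> = (\<Sum>j\<in>UNIV. cinner (e j) (c k) *s e j) $ i" by (simp only: onb_expansion[OF e])
    also have "\<dots> = (\<Sum>j\<in>UNIV. tens (e j) (w j)) $ (i, k)"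
      by (simp add: tens_def w_def mult.commute)
    finally show ?thesis .
  qed
  then have psi: "\<psi> = (\<Sum>j\<in>UNIV. tens (e j) (w j))" by (simp add: vec_eq_iff del: sum_component)
  have ff: "cinner (f i) (f j) = (if i = j \<and> s j \<noteq> 0 then 1 else 0)" for i j
    unfolding f_def cinner_scaleR_left cinner_scaleR_right ww by (simp add: power2_eq_square)
  show ?thesis
  proof (rule that[OF e s(1) _ ff])
    show "\<psi> = (\<Sum>j\<in>UNIV. s j *\<^sub>R tens (e j) (f j))"
      by (simp only: psi[unfolded w tens_scaleR_right])
    show "?X = (\<Sum>j\<in>UNIV. (s j)\<^sup>2 *\<^sub>R ketbra (e j))" by (simp only: Xe s(2))
  qed
qed

section \<open>The Schmidt sum and its dual norm\<close>

definition schmidt_sum :: "complex ^ ('a::finite \<times> 'b::finite) \<Rightarrow> real" where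
  "schmidt_sum \<psi> = Re (trace (psd_sqrt (partial_trace_B (ketbra \<psi>))))"

text \<open>The eigenvalues of the reduced operator are the squared Schmidt coefficients, so the
  trace of its root is their sum. Defining \<open>schmidt_sum\<close> by the reduced operator avoids
  choosing a decomposition.\<close>

lemma schmidt_sum_eq:
  assumes "onb e" "\<And>j. 0 \<le> s j"
    "partial_trace_B (ketbra \<psi>) = (\<Sum>j\<in>UNIV. (s j)\<^sup>2 *\<^sub>R ketbra (e j))"
  shows "schmidt_sum \<psi> = (\<Sum>j\<in>UNIV. s j)"
  unfolding schmidt_sum_def assms(3)
  by (subst trace_psd_sqrt[OF assms(1)]) (simp_all add: assms(2))

text \<open>The unit ball of the injective tensor norm. This norm is dual to
  \<open>schmidt_sum\<close>: \<open>product_contraction_cinner_le\<close> and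
  \<open>exists_dual_vector\<close> give the two halves.\<close>

definition product_contraction :: "complex ^ ('a::finite \<times> 'b::finite) \<Rightarrow> bool" where
  "product_contraction \<phi> \<longleftrightarrow> (\<forall>a b. cmod (cinner \<phi> (tens a b)) \<le> norm a * norm b)"

text \<open>Some \<open>f j\<close> may be zero, as in \<open>schmidt_decomposition\<close>;
  \<open>P\<close> marks the unit vectors. A coefficient outside \<open>P\<close> would count on the
  right only.\<close>

lemma norm_orthonormal_sum:
  fixes f :: "'i::finite \<Rightarrow> complex ^ 'n::finite"
  assumes f: "\<And>i j. cinner (f i) (f j) = (if i = j \<and> P j then 1 else 0)"
    and c: "\<And>j. \<not> P j \<Longrightarrow> c j = 0"
  shows "(norm (\<Sum>j\<in>UNIV. c j *s f j))\<^sup>2 = (\<Sum>j\<in>UNIV. (cmod (c j))\<^sup>2)"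
proof -
  define p where "p = (\<Sum>j\<in>UNIV. c j *s f j)"
  have "cinner (f i) p = (\<Sum>j\<in>UNIV. if i = j then c j else 0)" for i
    unfolding p_def cinner_sum_right cinner_mult_right
    using c by (intro sum.cong refl) (auto simp: f)
  then have "cinner p p = (\<Sum>i\<in>UNIV. c i * cnj (c i))"
    by (subst p_def) (simp add: cinner_sum_left cinner_mult_left mult.commute)
  then show ?thesis
    unfolding p_def cinner_self complex_norm_square[symmetric] by (simp only: of_real_sum[symmetric] of_real_eq_iff)
qed

text \<open>\<open>p\<close> is the orthogonal projection of \<open>b\<close> onto the span of the
  \<open>f j\<close>; \<open>(norm p)\<^sup>2 = cinner p b\<close> and Cauchy-Schwarz give
  \<open>norm p \<le> norm b\<close>.\<close>

lemma bessel:
  fixes f :: "'i::finite \<Rightarrow> complex ^ 'n::finite"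
  assumes f: "\<And>i j. cinner (f i) (f j) = (if i = j \<and> P j then 1 else 0)"
  shows "L2_set (\<lambda>j. cmod (cinner (f j) b)) UNIV \<le> norm b"
proof -
  define c where "c j = cinner (f j) b" for j
  define p where "p = (\<Sum>j\<in>UNIV. c j *s f j)"
  define t where "t = (\<Sum>j\<in>UNIV. (cmod (c j))\<^sup>2)"
  have "c j = 0" if "\<not> P j" for j
    using f[of j j] that by (simp add: c_def cinner_self)
  then have np: "(norm p)\<^sup>2 = t"
    unfolding p_def t_def by (rule norm_orthonormal_sum[OF f])
  have "cinner p b = of_real t"
    unfolding p_def cinner_sum_left cinner_mult_left t_def c_def[symmetric] of_real_sum
    by (simp only: complex_norm_square mult.commute)
  then have "cmod (cinner p b) = (norm p)\<^sup>2" by (simp add: np[symmetric] del: of_real_power)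
  then have "norm p * norm p \<le> norm p * norm b"
    using norm_cinner_le[of p b] by (simp add: power2_eq_square)
  then have "norm p \<le> norm b" by (cases "p = 0") simp_all
  then show ?thesis
    by (simp add: L2_set_def c_def[symmetric] t_def[symmetric] np[symmetric])
qed

text \<open>Replace all nonzero Schmidt coefficients of \<psi> by 1. Pairing with \<psi> then adds
  up the coefficients, and the contraction bound is Cauchy-Schwarz followed by Bessel's inequality
  on both factors.\<close>

lemma exists_dual_vector:
  fixes \<psi> :: "complex ^ ('a::finite \<times> 'b::finite)"
  shows "\<exists>\<phi>. product_contraction \<phi> \<and> cinner \<phi> \<psi> = of_real (schmidt_sum \<psi>)"
proof -
  obtain e and f :: "'a \<Rightarrow> complex ^ 'b" and s where S: "onb e" "\<And>j. 0 \<le> s j"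
    "\<psi> = (\<Sum>j\<in>UNIV. s j *\<^sub>R tens (e j) (f j))"
    "\<And>i j. cinner (f i) (f j) = (if i = j \<and> s j \<noteq> 0 then 1 else 0)"
    "partial_trace_B (ketbra \<psi>) = (\<Sum>j\<in>UNIV. (s j)\<^sup>2 *\<^sub>R ketbra (e j))"
    by (rule schmidt_decomposition[of \<psi>]) (rule that; assumption)
  have ee: "cinner (e i) (e j) = (if i = j \<and> True then 1 else 0)" for i j
    using S(1) by (simp add: onb_def)
  define \<phi> where "\<phi> = (\<Sum>j\<in>UNIV. tens (e j) (f j))"
  have "cmod (cinner \<phi> (tens a b)) \<le> norm a * norm b" for a b
  proof -
    have "cmod (cinner \<phi> (tens a b)) \<le> (\<Sum>j\<in>UNIV. \<bar>cmod (cinner (e j) a)\<bar> * \<bar>cmod (cinner (f j) b)\<bar>)"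
      unfolding \<phi>_def cinner_sum_left cinner_tens
      by (rule order_trans[OF norm_sum]) (simp add: norm_mult)
    also have "\<dots> \<le> L2_set (\<lambda>j. cmod (cinner (e j) a)) UNIV * L2_set (\<lambda>j. cmod (cinner (f j) b)) UNIV"
      by (rule L2_set_mult_ineq)
    also have "\<dots> \<le> norm a * norm b"
      by (intro mult_mono bessel[OF ee] bessel[OF S(4)]) simp_all
    finally show ?thesis .
  qed
  then have "product_contraction \<phi>" by (simp add: product_contraction_def)
  moreover have "cinner \<phi> \<psi> = of_real (schmidt_sum \<psi>)"
  proof -
    have "cinner (tens (e i) (f i)) \<psi> = (\<Sum>j\<in>UNIV. if i = j then of_real (s j) else 0)" for i
      by (subst S(3), unfold cinner_sum_right cinner_scaleR_right cinner_tens)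
         (intro sum.cong refl, simp add: S(4) ee)
    then have "cinner \<phi> \<psi> = (\<Sum>i\<in>UNIV. of_real (s i))"
      by (simp add: \<phi>_def cinner_sum_left)
    also have "\<dots> = of_real (schmidt_sum \<psi>)"
      by (simp add: schmidt_sum_eq[OF S(1,2,5)])
    finally show ?thesis .
  qed
  ultimately show ?thesis by blast
qed

text \<open>Triangle inequality along the Schmidt decomposition: each product term is weighted by
  \<open>s j\<close> and its vectors have norm at most 1.\<close>

lemma product_contraction_cinner_le:
  fixes \<psi> :: "complex ^ ('a::finite \<times> 'b::finite)"
  assumes "product_contraction \<phi>"
  shows "cmod (cinner \<phi> \<psi>) \<le> schmidt_sum \<psi>"
proof -
  obtain e and f :: "'a \<Rightarrow> complex ^ 'b" and s where S: "onb e" "\<And>j. 0 \<le> s j"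
    "\<psi> = (\<Sum>j\<in>UNIV. s j *\<^sub>R tens (e j) (f j))"
    "\<And>i j. cinner (f i) (f j) = (if i = j \<and> s j \<noteq> 0 then 1 else 0)"
    "partial_trace_B (ketbra \<psi>) = (\<Sum>j\<in>UNIV. (s j)\<^sup>2 *\<^sub>R ketbra (e j))"
    by (rule schmidt_decomposition[of \<psi>]) (rule that; assumption)
  have nf: "norm (f j) \<le> 1" for j
  proof -
    have "cmod (of_real ((norm (f j))\<^sup>2)) \<le> 1" unfolding cinner_self[symmetric] by (simp add: S(4))
    then show ?thesis by (simp only: norm_of_real abs_power2 power_le_one_iff norm_ge_zero) simp
  qed
  have "cmod (cinner \<phi> \<psi>) \<le> (\<Sum>j\<in>UNIV. s j * cmod (cinner \<phi> (tens (e j) (f j))))"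
    by (subst S(3), unfold cinner_sum_right cinner_scaleR_right, rule order_trans[OF norm_sum])
       (simp add: norm_mult S(2))
  also have "\<dots> \<le> (\<Sum>j\<in>UNIV. s j * 1)"
  proof (intro sum_mono mult_left_mono S(2))
    fix j
    have "cmod (cinner \<phi> (tens (e j) (f j))) \<le> norm (e j) * norm (f j)"
      using assms by (simp add: product_contraction_def)
    then show "cmod (cinner \<phi> (tens (e j) (f j))) \<le> 1" using nf[of j] by (simp add: onb_norm[OF S(1)])
  qed
  finally show ?thesis by (simp add: schmidt_sum_eq[OF S(1,2,5)])
qed

text \<open>By Cauchy-Schwarz a unit vector is itself a product contraction, and its pairing with
  itself is 1.\<close>

lemma schmidt_sum_ge_1:
  assumes "norm \<psi> = 1"
  shows "1 \<le> schmidt_sum \<psi>"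
proof -
  have "product_contraction \<psi>"
    unfolding product_contraction_def by (metis norm_cinner_le assms norm_tens mult_1)
  then show ?thesis
    using product_contraction_cinner_le[of \<psi> \<psi>] by (simp add: cinner_self assms)
qed

text \<open>The expectation is linear in \<open>\<sigma>\<close>, so product states suffice;
  spectral decomposition of both factors leaves a weighted mean of squared overlaps of \<phi> with
  product vectors, each at most 1.\<close>

lemma Sep_expectation_le_1:
  assumes \<phi>: "product_contraction \<phi>" and "\<sigma> \<in> Sep"
  shows "Re (cinner \<phi> (\<sigma> *v \<phi>)) \<le> 1"
proof -
  let ?T = "{X. Re (cinner \<phi> (X *v \<phi>)) \<le> 1}"
  have "Re (cinner \<phi> (tensor_op X Y *v \<phi>)) \<le> 1" if XY: "state X" "state Y" for X Y
  proof -
    obtain e p where X: "onb e" "X = (\<Sum>i\<in>UNIV. p i *\<^sub>R ketbra (e i))" "\<And>i. 0 \<le> p i"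
      using \<open>state X\<close>[unfolded state_def, THEN conjunct1]
      by (rule psd_spectral_decomposition) (rule that; assumption)
    obtain f q where Y: "onb f" "Y = (\<Sum>i\<in>UNIV. q i *\<^sub>R ketbra (f i))" "\<And>i. 0 \<le> q i"
      using \<open>state Y\<close>[unfolded state_def, THEN conjunct1]
      by (rule psd_spectral_decomposition) (rule that; assumption)
    have "complex_of_real (\<Sum>i\<in>UNIV. p i) = of_real 1"
      using XY(1) by (simp add: state_def X(2) trace_sum trace_scaleR trace_ketbra onb_norm[OF X(1)])
    then have p: "(\<Sum>i\<in>UNIV. p i) = 1" by (simp only: of_real_eq_iff)
    have "complex_of_real (\<Sum>i\<in>UNIV. q i) = of_real 1"
      using XY(2) by (simp add: state_def Y(2) trace_sum trace_scaleR trace_ketbra onb_norm[OF Y(1)])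
    then have q: "(\<Sum>i\<in>UNIV. q i) = 1" by (simp only: of_real_eq_iff)
    have "tensor_op X Y = (\<Sum>i\<in>UNIV. \<Sum>j\<in>UNIV. p i *\<^sub>R q j *\<^sub>R ketbra (tens (e i) (f j)))"
      unfolding X(2) Y(2) tensor_op_sum_left tensor_op_scaleR_left
      unfolding tensor_op_sum_right
        tensor_op_scaleR_right tensor_op_ketbra scaleR_sum_right ..
    then have "cinner \<phi> (tensor_op X Y *v \<phi>) =
        (\<Sum>i\<in>UNIV. \<Sum>j\<in>UNIV. of_real (p i * q j * (cmod (cinner (tens (e i) (f j)) \<phi>))\<^sup>2))"
      by (simp only: mult_vec_sum_left mult_vec_scaleR_left cinner_sum_right cinner_scaleR_right
          cinner_ketbra of_real_mult mult.assoc)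
    then have "Re (cinner \<phi> (tensor_op X Y *v \<phi>)) =
        (\<Sum>i\<in>UNIV. \<Sum>j\<in>UNIV. p i * q j * (cmod (cinner (tens (e i) (f j)) \<phi>))\<^sup>2)"
      by (simp only: Re_sum Re_complex_of_real)
    also have "\<dots> \<le> (\<Sum>i\<in>UNIV. \<Sum>j\<in>UNIV. p i * q j * 1)"
    proof (intro sum_mono mult_left_mono)
      fix i j
      have "cmod (cinner \<phi> (tens (e i) (f j))) \<le> norm (e i) * norm (f j)"
        using \<phi> by (simp add: product_contraction_def)
      then show "(cmod (cinner (tens (e i) (f j)) \<phi>))\<^sup>2 \<le> 1"
        by (simp add: norm_cinner_commute[of _ \<phi>] onb_norm[OF X(1)] onb_norm[OF Y(1)] power_le_one)
    qed (simp add: X Y)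
    also have "\<dots> = (\<Sum>i\<in>UNIV. p i) * (\<Sum>j\<in>UNIV. q j)" by (simp add: sum_product)
    finally show ?thesis by (simp add: p q)
  qed
  then have "{tensor_op \<sigma> \<tau> | \<sigma> \<tau>. state \<sigma> \<and> state \<tau>} \<subseteq> ?T" by auto
  moreover have "convex ?T"
    by (rule convexI)
      (simp add: matrix_vector_mult_add_rdistrib mult_vec_scaleR_left cinner_add_right
        cinner_scaleR_right convex_bound_le)
  ultimately have "Sep \<subseteq> ?T" unfolding Sep_def by (rule hull_minimal)
  then show ?thesis using assms(2) by blast
qed

lemma trace_Sep:
  assumes "\<sigma> \<in> Sep"
  shows "trace \<sigma> = 1"
proof -
  have "convex {X. trace X = (1 :: complex)}"
    by (rule convexI) (simp add: trace_add trace_scaleR flip: of_real_add)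
  moreover have "{tensor_op \<sigma> \<tau> | \<sigma> \<tau>. state \<sigma> \<and> state \<tau>} \<subseteq> {X. trace X = 1}"
    by (auto simp: state_def trace_tensor_op)
  ultimately have "Sep \<subseteq> {X. trace X = 1}" unfolding Sep_def by (intro hull_minimal)
  then show ?thesis using assms by blast
qed

section \<open>Generalized robustness of pure states\<close>

lemma psd_trace_zero:
  fixes X :: "'n::finite op"
  assumes "psd X" "trace X = 0"
  shows "X = 0"
proof -
  obtain e l where X: "onb e" "X = (\<Sum>j\<in>UNIV. l j *\<^sub>R ketbra (e j))" "\<And>j. 0 \<le> l j"
    using assms(1) by (rule psd_spectral_decomposition) (rule that; assumption)
  have "complex_of_real (\<Sum>j\<in>UNIV. l j) = of_real 0"
    using assms(2) by (simp add: X(2) trace_sum trace_scaleR trace_ketbra onb_norm[OF X(1)])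
  then have "(\<Sum>j\<in>UNIV. l j) = 0" by (simp only: of_real_eq_iff)
  then have "\<forall>j. l j = 0" using X(3) by (simp add: sum_nonneg_eq_0_iff)
  then show ?thesis by (simp add: X(2))
qed

lemma scaleR_vec: "r *\<^sub>R v = complex_of_real r *s v"
  by (simp add: vec_eq_iff scaleR_complex)

text \<open>Sign vectors are encoded as subsets of \<open>'a\<close>. For
  \<open>j \<noteq> k\<close>, toggling membership of \<open>j\<close> is an involution that negates
  every term.\<close>

lemma sum_signs_orthogonal:
  fixes \<theta> :: "'a::finite set \<Rightarrow> 'a \<Rightarrow> real"
  defines "\<theta> \<equiv> \<lambda>S j. if j \<in> S then 1 else - 1"
  shows "(\<Sum>S\<in>UNIV. \<theta> S j * \<theta> S k) = (if j = k then real (card (UNIV :: 'a set set)) else 0)"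
proof (cases "j = k")
  case True
  then show ?thesis by (simp add: \<theta>_def if_distrib cong: if_cong)
next
  case False
  define h where "h S = (if j \<in> S then S - {j} else insert j S)" for S
  have hh: "h (h S) = S" for S by (auto simp: h_def)
  have "(\<Sum>S\<in>UNIV. \<theta> S j * \<theta> S k) = (\<Sum>S\<in>UNIV. - (\<theta> S j * \<theta> S k))"
    by (rule sum.reindex_bij_witness[of _ h h]) (use False in \<open>auto simp: hh\<close>, auto simp: h_def \<theta>_def)
  then show ?thesis using False by (simp add: sum_negf)
qed

text \<open>With independent uniform signs \<open>\<theta>\<^sub>j\<close>, the product vector
  \<open>(\<Sum>\<^sub>j \<theta>\<^sub>j \<surd>s\<^sub>j e\<^sub>j) \<otimes> (\<Sum>\<^sub>k \<theta>\<^sub>k \<surd>s\<^sub>k f\<^sub>k)\<close> has mean \<open>\<psi>\<close> and constant norm \<open>\<Sum>\<^sub>j s\<^sub>j\<close>. The mean of its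
  projectors is separable up to normalization and dominates the projector of its mean.\<close>

lemma exists_separable_dominating:
  fixes \<psi> :: "complex ^ ('a::finite \<times> 'b::finite)"
  assumes "norm \<psi> = 1"
  shows "\<exists>\<sigma>\<in>Sep. psd ((schmidt_sum \<psi>)\<^sup>2 *\<^sub>R \<sigma> - ketbra \<psi>)"
proof -
  obtain e and f :: "'a \<Rightarrow> complex ^ 'b" and s where S: "onb e" "\<And>j. 0 \<le> s j"
    "\<psi> = (\<Sum>j\<in>UNIV. s j *\<^sub>R tens (e j) (f j))"
    "\<And>i j. cinner (f i) (f j) = (if i = j \<and> s j \<noteq> 0 then 1 else 0)"
    "partial_trace_B (ketbra \<psi>) = (\<Sum>j\<in>UNIV. (s j)\<^sup>2 *\<^sub>R ketbra (e j))"
    by (rule schmidt_decomposition[of \<psi>]) (rule that; assumption)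
  have ee: "cinner (e i) (e j) = (if i = j \<and> True then 1 else 0)" for i j
    using S(1) by (simp add: onb_def)
  define c where "c = (\<Sum>j\<in>UNIV. s j)"
  have c: "schmidt_sum \<psi> = c" unfolding c_def by (rule schmidt_sum_eq[OF S(1,2,5)])
  have c1: "c \<ge> 1" using schmidt_sum_ge_1[OF assms] by (simp add: c)
  define \<theta> :: "'a set \<Rightarrow> 'a \<Rightarrow> real" where "\<theta> = (\<lambda>S j. if j \<in> S then 1 else - 1)"
  define r where "r S j = sqrt (s j) * \<theta> S j" for S j
  define a where "a S = (\<Sum>j\<in>UNIV. r S j *\<^sub>R e j)" for S
  define b where "b S = (\<Sum>j\<in>UNIV. r S j *\<^sub>R f j)" for S
  define v where "v S = tens (a S) (b S)" for S
  define N where "N = real (card (UNIV :: 'a set set))"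
  have N: "N > 0" by (simp add: N_def card_gt_0_iff)
  have rr: "(cmod (of_real (r S j)))\<^sup>2 = s j" for S j
    using S(2)[of j] by (simp add: r_def \<theta>_def norm_mult power_mult_distrib)
  have na: "(norm (a S))\<^sup>2 = c" for S
    unfolding a_def scaleR_vec by (subst norm_orthonormal_sum[OF ee]) (simp_all only: rr c_def simp_thms)
  \<comment> \<open>The coefficients \<open>r S j\<close> vanish together with \<open>s j\<close>,
    as \<open>norm_orthonormal_sum\<close> demands for the zero vectors \<open>f j\<close>.\<close>
  have nb: "(norm (b S))\<^sup>2 = c" for S
    unfolding b_def scaleR_vec
    by (subst norm_orthonormal_sum[OF S(4)]) (simp_all only: rr c_def, simp add: r_def)
  have v: "v S = (\<Sum>j\<in>UNIV. \<Sum>k\<in>UNIV. (sqrt (s j) * sqrt (s k) * (\<theta> S j * \<theta> S k)) *\<^sub>R tens (e j) (f k))" for S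
    unfolding v_def a_def b_def tens_sum_left tens_scaleR_left
    unfolding tens_sum_right tens_scaleR_right scaleR_sum_right scaleR_scaleR r_def
    by (intro sum.cong refl arg_cong2[of _ _ _ _ "(*\<^sub>R)"]) (simp add: mult_ac)
  have "(\<Sum>S\<in>UNIV. v S) = (\<Sum>j\<in>UNIV. \<Sum>k\<in>UNIV. \<Sum>S\<in>UNIV. (sqrt (s j) * sqrt (s k) * (\<theta> S j * \<theta> S k)) *\<^sub>R tens (e j) (f k))"
    unfolding v by (subst sum.swap, intro sum.cong refl, subst sum.swap) (rule refl)
  \<comment> \<open>Summing over the signs kills every cross term
    \<open>j \<noteq> k\<close>.\<close>
  also have "\<dots> = (\<Sum>j\<in>UNIV. \<Sum>k\<in>UNIV. if j = k then (s j * N) *\<^sub>R tens (e j) (f j) else 0)"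
    unfolding scaleR_sum_left[symmetric] sum_distrib_left[symmetric] \<theta>_def sum_signs_orthogonal N_def[symmetric]
    using S(2) by (intro sum.cong refl) simp
  also have "\<dots> = N *\<^sub>R \<psi>"
    by (subst S(3)) (simp add: scaleR_sum_right mult.commute)
  finally have mean: "(\<Sum>S\<in>UNIV. v S) = N *\<^sub>R \<psi>" .
  define \<sigma> where "\<sigma> = (\<Sum>S\<in>UNIV. (1 / N) *\<^sub>R tensor_op ((1 / c) *\<^sub>R ketbra (a S)) ((1 / c) *\<^sub>R ketbra (b S)))"
  have st: "state ((1 / c) *\<^sub>R ketbra x)" if "(norm x)\<^sup>2 = c" for x :: "complex ^ 'k::finite"
    using c1 psd_sum_ketbra[of "{x}" "\<lambda>_. 1 / c" id] that
    by (simp add: state_def trace_scaleR trace_ketbra del: of_real_power)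
  have "\<sigma> \<in> Sep"
    unfolding \<sigma>_def
  proof (rule convex_sum)
    show "convex (Sep :: ('a \<times> 'b) op set)" by (simp add: Sep_def)
    show "(\<Sum>S\<in>(UNIV :: 'a set set). 1 / N) = 1" using N by (simp add: N_def)
    show "tensor_op ((1 / c) *\<^sub>R ketbra (a S)) ((1 / c) *\<^sub>R ketbra (b S)) \<in> Sep" for S
      unfolding Sep_def
      by (rule hull_inc, rule CollectI, intro exI conjI, rule refl) (rule st[OF na] st[OF nb])+
  qed (use N in auto)
  moreover have "psd (c\<^sup>2 *\<^sub>R \<sigma> - ketbra \<psi>)"
  proof -
    have \<sigma>: "c\<^sup>2 *\<^sub>R \<sigma> = (\<Sum>S\<in>UNIV. (1 / N) *\<^sub>R ketbra (v S))"
      using c1 by (simp add: \<sigma>_def tensor_op_scaleR_left tensor_op_scaleR_right tensor_op_ketbra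
          scaleR_sum_right v_def power2_eq_square)
    \<comment> \<open>Domination is Cauchy-Schwarz for the mean: the squared modulus of the average
      of \<open>cinner (v S) x\<close> is at most the average of the squared moduli.\<close>
    have "(cmod (cinner \<psi> x))\<^sup>2 \<le> Re (cinner x ((c\<^sup>2 *\<^sub>R \<sigma>) *v x))" for x
    proof -
      have "N * cmod (cinner \<psi> x) = cmod (\<Sum>S\<in>UNIV. cinner (v S) x)"
        unfolding cinner_sum_left[symmetric] mean using N by (simp add: cinner_scaleR_left norm_mult)
      also have "\<dots> \<le> (\<Sum>S\<in>UNIV. cmod (cinner (v S) x))" by (rule norm_sum)
      finally have "(N * cmod (cinner \<psi> x))\<^sup>2 \<le> (\<Sum>S\<in>UNIV. cmod (cinner (v S) x))\<^sup>2"
        using N by (intro power_mono) simp_all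
      also have "\<dots> \<le> (\<Sum>S\<in>UNIV. (cmod (cinner (v S) x))\<^sup>2) * N"
        unfolding N_def by (rule sum_squared_le_sum_of_squares)
      finally have "N * (cmod (cinner \<psi> x))\<^sup>2 \<le> (\<Sum>S\<in>UNIV. (cmod (cinner (v S) x))\<^sup>2)"
        using N by (simp add: power_mult_distrib power2_eq_square mult_ac)
      then have "(cmod (cinner \<psi> x))\<^sup>2 \<le> (\<Sum>S\<in>UNIV. (cmod (cinner (v S) x))\<^sup>2) / N"
        using N by (simp add: field_simps)
      also have "\<dots> = Re (cinner x ((c\<^sup>2 *\<^sub>R \<sigma>) *v x))"
        unfolding \<sigma> mult_vec_sum_left mult_vec_scaleR_left cinner_sum_right cinner_scaleR_right cinner_ketbra
          of_real_mult[symmetric] of_real_sum[symmetric] Re_complex_of_real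
        by (simp add: sum_divide_distrib)
      finally show ?thesis .
    qed
    moreover have "dagger (c\<^sup>2 *\<^sub>R \<sigma> - ketbra \<psi>) = c\<^sup>2 *\<^sub>R \<sigma> - ketbra \<psi>"
      unfolding \<sigma> by (simp add: dagger_diff dagger_sum dagger_scaleR dagger_ketbra)
    ultimately show ?thesis
      unfolding psd_iff by (simp add: matrix_vector_mult_diff_rdistrib cinner_diff_right cinner_ketbra del: of_real_power)
  qed
  ultimately show ?thesis unfolding c by blast
qed

section \<open>The robustness of a pure state\<close>

lemma psd_scaleR: "psd X \<Longrightarrow> 0 \<le> r \<Longrightarrow> psd (r *\<^sub>R X)"
  by (simp add: psd_iff dagger_scaleR mult_vec_scaleR_left cinner_scaleR_right)

lemma psd_ketbra: "psd (ketbra x)"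
  by (simp add: psd_iff dagger_ketbra cinner_ketbra del: of_real_power)

text \<open>\<open>LEAST\<close> over the reals calls for an attained value and a lower bound. The
  noise state is the normalized difference between
  \<open>(schmidt_sum \<psi>)\<^sup>2 *\<^sub>R \<sigma>\<close> and the projector of \<psi>; the
  bound evaluates the separable mixture on a dual vector.\<close>

lemma generalized_robustness_ketbra:
  fixes \<psi> :: "complex ^ ('a::finite \<times> 'b::finite)"
  assumes "norm \<psi> = 1"
  shows "generalized_robustness (ketbra \<psi>) = (schmidt_sum \<psi>)\<^sup>2 - 1"
  unfolding generalized_robustness_def
proof (rule Least_equality)
  define c where "c = schmidt_sum \<psi>"
  have c1: "c \<ge> 1" using schmidt_sum_ge_1[OF assms] by (simp add: c_def)
  obtain \<sigma> where \<sigma>: "\<sigma> \<in> Sep" "psd (c\<^sup>2 *\<^sub>R \<sigma> - ketbra \<psi>)"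
    using exists_separable_dominating[OF assms] unfolding c_def by blast
  have tr: "trace (c\<^sup>2 *\<^sub>R \<sigma> - ketbra \<psi>) = of_real (c\<^sup>2 - 1)"
    by (simp add: trace_sub trace_scaleR trace_Sep[OF \<sigma>(1)] trace_ketbra assms)
  have "\<exists>\<rho>\<^sub>s. state \<rho>\<^sub>s \<and> ketbra \<psi> + (c\<^sup>2 - 1) *\<^sub>R \<rho>\<^sub>s = c\<^sup>2 *\<^sub>R \<sigma>"
  proof (cases "c = 1")
    \<comment> \<open>Normalizing is impossible here: the difference has trace zero and vanishes,
      and with weight zero any state can serve as \<open>\<rho>\<^sub>s\<close>.\<close>
    case True
    then have "c\<^sup>2 *\<^sub>R \<sigma> - ketbra \<psi> = 0" using tr by (intro psd_trace_zero[OF \<sigma>(2)]) simp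
    moreover have "state (ketbra \<psi>)" by (simp add: state_def psd_ketbra trace_ketbra assms)
    ultimately show ?thesis using True by (intro exI[of _ "ketbra \<psi>"]) simp
  next
    case False
    then have "c\<^sup>2 - 1 > 0" using c1 by (simp add: one_less_power)
    then have "state ((1 / (c\<^sup>2 - 1)) *\<^sub>R (c\<^sup>2 *\<^sub>R \<sigma> - ketbra \<psi>))"
      unfolding state_def trace_scaleR tr of_real_mult[symmetric] by (simp add: psd_scaleR \<sigma>(2) del: of_real_mult)
    then show ?thesis using \<open>c\<^sup>2 - 1 > 0\<close> by (intro exI conjI) (assumption, simp)
  qed
  then show "0 \<le> (schmidt_sum \<psi>)\<^sup>2 - 1 \<and> (\<exists>\<rho>\<^sub>s. state \<rho>\<^sub>s \<and>
      (1 / (1 + ((schmidt_sum \<psi>)\<^sup>2 - 1))) *\<^sub>R (ketbra \<psi> + ((schmidt_sum \<psi>)\<^sup>2 - 1) *\<^sub>R \<rho>\<^sub>s) \<in> Sep)"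
    unfolding c_def[symmetric] using c1 \<sigma>(1) by auto
next
  fix t assume "0 \<le> t \<and> (\<exists>\<rho>\<^sub>s. state \<rho>\<^sub>s \<and> (1 / (1 + t)) *\<^sub>R (ketbra \<psi> + t *\<^sub>R \<rho>\<^sub>s) \<in> Sep)"
  then obtain \<rho>\<^sub>s where t: "0 \<le> t" "state \<rho>\<^sub>s" "(1 / (1 + t)) *\<^sub>R (ketbra \<psi> + t *\<^sub>R \<rho>\<^sub>s) \<in> Sep" by blast
  \<comment> \<open>On \<open>\<phi>\<close> the projector contributes
    \<open>(schmidt_sum \<psi>)\<^sup>2\<close> and \<open>\<rho>\<^sub>s\<close> a nonnegative
    amount, while \<open>Sep_expectation_le_1\<close> caps the total at
    \<open>1 + t\<close>.\<close>
  obtain \<phi> where \<phi>: "product_contraction \<phi>" "cinner \<phi> \<psi> = of_real (schmidt_sum \<psi>)"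
    using exists_dual_vector by blast
  have "cmod (cinner \<psi> \<phi>) = schmidt_sum \<psi>"
    using schmidt_sum_ge_1[OF assms] by (simp add: norm_cinner_commute[of \<psi>] \<phi>(2))
  then have "Re (cinner \<phi> (((1 / (1 + t)) *\<^sub>R (ketbra \<psi> + t *\<^sub>R \<rho>\<^sub>s)) *v \<phi>)) =
      1 / (1 + t) * ((schmidt_sum \<psi>)\<^sup>2 + t * Re (cinner \<phi> (\<rho>\<^sub>s *v \<phi>)))"
    unfolding mult_vec_scaleR_left matrix_vector_mult_add_rdistrib cinner_scaleR_right cinner_add_right cinner_ketbra
    by (simp del: of_real_power of_real_divide of_real_add)
  then have "1 / (1 + t) * ((schmidt_sum \<psi>)\<^sup>2 + t * Re (cinner \<phi> (\<rho>\<^sub>s *v \<phi>))) \<le> 1"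
    using Sep_expectation_le_1[OF \<phi>(1) t(3)] by simp
  then have "(schmidt_sum \<psi>)\<^sup>2 + t * Re (cinner \<phi> (\<rho>\<^sub>s *v \<phi>)) \<le> 1 + t"
    using t(1) by (simp add: divide_simps)
  moreover have "0 \<le> t * Re (cinner \<phi> (\<rho>\<^sub>s *v \<phi>))"
    using t(1,2) by (simp add: state_def psd_iff)
  ultimately show "(schmidt_sum \<psi>)\<^sup>2 - 1 \<le> t" by simp
qed

lemma renyi_half_partial_trace_ketbra:
  "renyi_half (partial_trace_B (ketbra \<psi>)) = 2 * log 2 (schmidt_sum \<psi>)"
  by (simp add: renyi_half_def schmidt_sum_def)

text \<open>Both sides are \<open>2 * log 2 (schmidt_sum \<psi>)\<close>, since 1 plus the
  robustness is \<open>(schmidt_sum \<psi>)\<^sup>2\<close>.\<close>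

lemma log_generalized_robustness_ketbra:
  assumes "norm \<psi> = 1"
  shows "log_generalized_robustness (ketbra \<psi>) = renyi_half (partial_trace_B (ketbra \<psi>))"
  using schmidt_sum_ge_1[OF assms]
  by (simp add: log_generalized_robustness_def generalized_robustness_ketbra[OF assms]
      renyi_half_partial_trace_ketbra log_nat_power)

section \<open>Ensemble averages\<close>

text \<open>Testing on products of standard basis vectors bounds every entry of \<phi> by 1. The
  bound is crude but uniform in \<phi>, which is what the Lipschitz estimate for
  \<open>schmidt_sum\<close> uses.\<close>

lemma norm_product_contraction_le:
  fixes \<phi> :: "complex ^ ('a::finite \<times> 'b::finite)"
  assumes "product_contraction \<phi>"
  shows "norm \<phi> \<le> real CARD('a \<times> 'b)"
proof -
  have n1: "norm (axis i (1 :: complex)) = 1" for i :: "'k::finite"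
    by (simp only: norm_eq_1 inner_axis) (simp add: axis_def)
  have "cmod (\<phi> $ p) \<le> 1" for p
  proof -
    have "tens (axis (fst p) 1) (axis (snd p) 1) $ q = (if p = q then 1 else 0)" for q
      by (auto simp: tens_def axis_def prod_eq_iff)
    then have "cinner \<phi> (tens (axis (fst p) 1) (axis (snd p) 1)) = cnj (\<phi> $ p)"
      unfolding cinner_def by (simp only: if_distrib[of "(*) x" for x] mult_1_right mult_zero_right) simp
    moreover have "cmod (cinner \<phi> (tens (axis (fst p) 1) (axis (snd p) 1))) \<le>
        norm (axis (fst p) (1 :: complex)) * norm (axis (snd p) (1 :: complex))"
      using assms unfolding product_contraction_def by blast
    ultimately show ?thesis by (simp add: n1)
  qed
  then have "(\<Sum>p\<in>UNIV. cmod (\<phi> $ p)) \<le> (\<Sum>p\<in>(UNIV :: ('a \<times> 'b) set). 1)" by (intro sum_mono)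
  then show ?thesis
    unfolding norm_vec_def using L2_set_le_sum[of UNIV "\<lambda>p. cmod (\<phi> $ p)"] by simp
qed

text \<open>A dual vector optimal for \<open>x\<close> also bounds \<open>schmidt_sum y\<close> from
  below, with error at most \<open>K * norm (x - y)\<close>; exchanging \<open>x\<close> and
  \<open>y\<close> gives the Lipschitz constant \<open>K\<close>.\<close>

lemma continuous_on_schmidt_sum:
  "continuous_on S (schmidt_sum :: complex ^ ('a::finite \<times> 'b::finite) \<Rightarrow> real)"
proof -
  define K where "K = real CARD('a \<times> 'b)"
  have le: "schmidt_sum x \<le> schmidt_sum y + K * norm (x - y)" for x y :: "complex ^ ('a \<times> 'b)"
  proof -
    obtain \<phi> where \<phi>: "product_contraction \<phi>" "cinner \<phi> x = of_real (schmidt_sum x)"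
      using exists_dual_vector by blast
    have "cinner \<phi> x = cinner \<phi> y + cinner \<phi> (x - y)" by (simp add: cinner_diff_right)
    then have "schmidt_sum x = Re (cinner \<phi> y) + Re (cinner \<phi> (x - y))"
      using \<phi>(2) by (metis Re_complex_of_real plus_complex.simps(1))
    also have "\<dots> \<le> cmod (cinner \<phi> y) + cmod (cinner \<phi> (x - y))"
      by (intro add_mono complex_Re_le_cmod)
    also have "\<dots> \<le> schmidt_sum y + norm \<phi> * norm (x - y)"
      by (intro add_mono product_contraction_cinner_le[OF \<phi>(1)] norm_cinner_le)
    also have "norm \<phi> * norm (x - y) \<le> K * norm (x - y)"
      unfolding K_def by (intro mult_right_mono norm_product_contraction_le[OF \<phi>(1)]) simp
    finally show ?thesis by simp
  qed
  have "K-lipschitz_on S schmidt_sum"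
  proof (rule lipschitz_onI)
    fix x y :: "complex ^ ('a \<times> 'b)"
    show "dist (schmidt_sum x) (schmidt_sum y) \<le> K * dist x y"
      using le[of x y] le[of y x] by (simp add: dist_norm norm_minus_commute abs_le_iff)
  qed (simp add: K_def)
  then show ?thesis by (rule lipschitz_on_continuous_on)
qed

section \<open>Ensemble averages as slices of a convex hull\<close>

lemma sum_list_conv_sum_nth: "(\<Sum>x\<leftarrow>E. h x) = (\<Sum>i = 0..<length E. h (E ! i))"
  by (simp add: sum_list_sum_nth)

text \<open>Attaching to each projector its value turns an ensemble into a convex combination of
  pairs; the first component fixes the state, the second is the average. Ensembles of all lengths
  are covered at once.\<close>

lemma ensemble_averages_eq_convex_hull:
  "ensemble_averages g \<rho> = {t. (\<rho>, t) \<in> convex hull ((\<lambda>\<psi>. (ketbra \<psi>, g (ketbra \<psi>))) ` sphere 0 1)}"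
    (is "_ = {t. _ \<in> convex hull (?h ` _)}")
proof (intro equalityI subsetI)
  fix t assume "t \<in> ensemble_averages g \<rho>"
  then obtain E where E: "pure_ensemble \<rho> E" "t = (\<Sum>(p, \<psi>)\<leftarrow>E. p * g (ketbra \<psi>))"
    unfolding ensemble_averages_def by blast
  have mem: "0 \<le> fst (E ! i) \<and> norm (snd (E ! i)) = 1" if "i \<in> {0..<length E}" for i
    using E(1) nth_mem[of i E] that unfolding pure_ensemble_def by fastforce
  have "(\<Sum>i = 0..<length E. fst (E ! i) *\<^sub>R ?h (snd (E ! i))) \<in> convex hull (?h ` sphere 0 1)"
  proof (rule convex_sum)
    show "(\<Sum>i = 0..<length E. fst (E ! i)) = 1"
      using E(1) by (simp add: pure_ensemble_def sum_list_conv_sum_nth case_prod_beta)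
  qed (use mem in \<open>auto intro!: hull_inc imageI\<close>)
  moreover have "(\<Sum>i = 0..<length E. fst (E ! i) *\<^sub>R ?h (snd (E ! i))) = (\<rho>, t)"
    using E by (simp add: pure_ensemble_def sum_list_conv_sum_nth case_prod_beta prod_eq_iff fst_sum snd_sum)
  ultimately show "t \<in> {t. (\<rho>, t) \<in> convex hull (?h ` sphere 0 1)}" by simp
next
  fix t assume "t \<in> {t. (\<rho>, t) \<in> convex hull (?h ` sphere 0 1)}"
  then obtain k :: nat and u x where ux: "\<forall>i\<in>{1..k}. 0 \<le> u i \<and> x i \<in> ?h ` sphere 0 1"
    "sum u {1..k} = 1" "(\<Sum>i = 1..k. u i *\<^sub>R x i) = (\<rho>, t)"
    unfolding convex_hull_indexed by blast
  have "\<forall>i\<in>{1..k}. \<exists>\<psi>. norm \<psi> = 1 \<and> x i = ?h \<psi>"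
  proof
    fix i assume "i \<in> {1..k}"
    then have "x i \<in> ?h ` sphere 0 1" using ux(1) by blast
    then show "\<exists>\<psi>. norm \<psi> = 1 \<and> x i = ?h \<psi>" by auto
  qed
  then obtain \<psi> where \<psi>: "\<And>i. i \<in> {1..k} \<Longrightarrow> norm (\<psi> i) = 1 \<and> x i = ?h (\<psi> i)" by metis
  \<comment> \<open>The hull description numbers its points from 1 to \<open>k\<close>, hence the
    range up to \<open>Suc k\<close>.\<close>
  define E where "E = map (\<lambda>i. (u i, \<psi> i)) [1..<Suc k]"
  have sumE: "(\<Sum>(p, \<psi>)\<leftarrow>E. F p \<psi>) = (\<Sum>i = 1..k. F (u i) (\<psi> i))" for F :: "_ \<Rightarrow> _ \<Rightarrow> 'z::comm_monoid_add"
    by (simp add: E_def comp_def interv_sum_list_conv_sum_set_nat atLeastLessThanSuc_atLeastAtMost del: upt_Suc)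
  have "(\<Sum>i = 1..k. u i *\<^sub>R ?h (\<psi> i)) = (\<Sum>i = 1..k. u i *\<^sub>R x i)"
    by (intro sum.cong refl) (simp only: \<psi>)
  then have "(\<Sum>i = 1..k. u i *\<^sub>R ?h (\<psi> i)) = (\<rho>, t)"
    using ux(3) by (rule trans)
  then have "(\<Sum>i = 1..k. u i *\<^sub>R ketbra (\<psi> i)) = \<rho>" "(\<Sum>i = 1..k. u i * g (ketbra (\<psi> i))) = t"
    by (simp_all add: prod_eq_iff fst_sum snd_sum)
  moreover have "\<forall>(p, \<psi>) \<in> set E. 0 \<le> p \<and> norm \<psi> = 1"
    using ux(1) \<psi> by (auto simp: E_def)
  ultimately have "pure_ensemble \<rho> E" "t = (\<Sum>(p, \<psi>)\<leftarrow>E. p * g (ketbra \<psi>))"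
    unfolding pure_ensemble_def sumE using ux(2) by simp_all
  then show "t \<in> ensemble_averages g \<rho>" unfolding ensemble_averages_def by blast
qed

text \<open>The eigenbasis of \<open>\<rho>\<close>, weighted by its eigenvalues, is an
  ensemble.\<close>

lemma ensemble_averages_nonempty:
  fixes \<rho> :: "'n::finite op"
  assumes "state \<rho>"
  shows "ensemble_averages g \<rho> \<noteq> {}"
proof -
  obtain e l where X: "onb e" "\<rho> = (\<Sum>j\<in>UNIV. l j *\<^sub>R ketbra (e j))" "\<And>j. 0 \<le> l j"
    using assms[unfolded state_def, THEN conjunct1]
    by (rule psd_spectral_decomposition) (rule that; assumption)
  have "complex_of_real (\<Sum>i\<in>UNIV. l i) = of_real 1"
    using assms by (simp add: state_def X(2) trace_sum trace_scaleR trace_ketbra onb_norm[OF X(1)])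
  then have l: "(\<Sum>i\<in>UNIV. l i) = 1" by (simp only: of_real_eq_iff)
  let ?h = "\<lambda>\<psi>. (ketbra \<psi>, g (ketbra \<psi>))"
  have "(\<Sum>j\<in>UNIV. l j *\<^sub>R ?h (e j)) \<in> convex hull (?h ` sphere 0 1)"
    by (rule convex_sum) (auto simp: l X(3) onb_norm[OF X(1)] intro!: hull_inc imageI)
  moreover have "(\<Sum>j\<in>UNIV. l j *\<^sub>R ?h (e j)) = (\<rho>, \<Sum>j\<in>UNIV. l j * g (ketbra (e j)))"
    by (simp add: prod_eq_iff fst_sum snd_sum X(2))
  ultimately show ?thesis unfolding ensemble_averages_eq_convex_hull by auto
qed

lemma continuous_on_ketbra: "continuous_on S ketbra"
  unfolding ketbra_def by (intro continuous_on_vec_lambda continuous_intros)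

text \<open>The unit sphere is compact, and so is the convex hull of its continuous image in finite
  dimension; cutting with the closed set over \<open>\<rho>\<close> and projecting keep
  compactness.\<close>

lemma compact_ensemble_averages:
  assumes "continuous_on (sphere 0 1) (\<lambda>\<psi>. g (ketbra \<psi>))"
  shows "compact (ensemble_averages g \<rho>)"
proof -
  let ?H = "convex hull ((\<lambda>\<psi>. (ketbra \<psi>, g (ketbra \<psi>))) ` sphere 0 1)"
  have H: "compact ?H"
    by (intro compact_convex_hull compact_continuous_image continuous_on_Pair continuous_on_ketbra assms) simp
  have "ensemble_averages g \<rho> = snd ` (?H \<inter> {\<rho>} \<times> UNIV)"
    unfolding ensemble_averages_eq_convex_hull
  proof (intro equalityI subsetI)
    fix t assume "t \<in> {t. (\<rho>, t) \<in> ?H}"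
    then show "t \<in> snd ` (?H \<inter> {\<rho>} \<times> UNIV)"
      by (intro image_eqI[of _ _ "(\<rho>, t)"]) simp_all
  qed auto
  moreover have "compact (snd ` (?H \<inter> {\<rho>} \<times> UNIV))"
    by (intro compact_continuous_image continuous_intros compact_Int_closed[OF H] closed_Times)
  ultimately show ?thesis by simp
qed

theorem mainTheorem8:
  fixes \<rho> :: "('a::finite \<times> 'b::finite) op"
  assumes "state \<rho>"
  shows "eof_half \<rho> \<in> ensemble_averages log_generalized_robustness \<rho> \<and>
         (\<forall>x \<in> ensemble_averages log_generalized_robustness \<rho>. eof_half \<rho> \<le> x)"
proof -
  let ?g = "\<lambda>X :: ('a \<times> 'b) op. renyi_half (partial_trace_B X)"
  let ?A = "ensemble_averages ?g \<rho>"
  \<comment> \<open>The two functionals are known to agree on projectors of unit vectors, so they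
    are compared as maps on the sphere.\<close>
  have "(\<lambda>\<psi> :: complex ^ ('a \<times> 'b). (ketbra \<psi>, log_generalized_robustness (ketbra \<psi>))) ` sphere 0 1 =
      (\<lambda>\<psi>. (ketbra \<psi>, ?g (ketbra \<psi>))) ` sphere 0 1"
    by (intro image_cong refl) (simp add: log_generalized_robustness_ketbra)
  then have eq: "ensemble_averages log_generalized_robustness \<rho> = ?A"
    unfolding ensemble_averages_eq_convex_hull by simp
  \<comment> \<open>\<open>schmidt_sum\<close> is at least 1 on the sphere, which keeps the
    logarithm continuous.\<close>
  have "continuous_on (sphere 0 1) (\<lambda>\<psi> :: complex ^ ('a \<times> 'b). ?g (ketbra \<psi>))"
    unfolding renyi_half_partial_trace_ketbra log_def
    using schmidt_sum_ge_1 by (intro continuous_intros continuous_on_schmidt_sum) force+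
  then have "compact ?A" by (rule compact_ensemble_averages)
  moreover from this have "bdd_below ?A" by (intro bounded_imp_bdd_below compact_imp_bounded)
  \<comment> \<open>A nonempty compact set of reals contains its infimum, so the minimum is
    attained.\<close>
  ultimately show ?thesis
    unfolding eq eof_half_def
    by (intro conjI ballI closed_contains_Inf ensemble_averages_nonempty[OF assms] compact_imp_closed cInf_lower)
qed

end
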